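(* Let $A\in\mathbb{R}^{m\times n}$ have rows $a_1^\top,\dots,a_m^\top$, all nonzero, and let $b\in\mathbb{R}^m$ be such that the linear system $Ax=b$ is consistent. Let $x^{(0)}=x^{(1)}\in\mathbb{R}^n$, $\theta\in[0,1]$, and let $x^\star=A^\dagger b+(I-A^\dagger A)x^{(0)}$ denote the orthogonal projection of $x^{(0)}$ onto the solution set of $Ax=b$. Let $\beta\ge 0$, and assume that $\alpha\in(0,2)$ if $\beta=0$, or $\alpha\in(0,1+\beta)$ if $\beta>0$. Assume further that $$\gamma_1=2\beta^2+3\beta+1-(3\alpha\beta+2\alpha-\alpha^2)\frac{\sigma_{\min}^2(A)}{\|A\|_F^2}\quad\text{and}\quad\gamma_2=2\beta^2+\beta$$ satisfy $\gamma_1+\gamma_2<1$. Let $\{x^{(k)}\}_{k\ge 0}$ be any iteration sequence generated by the improved greedy randomized Kaczmarz method with momentum (mGRK) with parameters $\alpha,\beta,\theta$ and initial points $x^{(0)}=x^{(1)}$. Then, deterministically (that is, for every realization of the random indices $i_k\in\mathcal{S}_k$), for every $k\ge 0$, $$\|x^{(k+1)}-x^\star\|_2^2\le q^k(1+\delta)\|x^{(0)}-x^\star\|_2^2,$$ where $q=\frac{\gamma_1+\sqrt{\gamma_1^2+4\gamma_2}}{2}$ and $\delta=q-\gamma_1$. Moreover, $\gamma_1+\gamma_2\le q<1$.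
   Context: Notation: $[m]=\{1,\dots,m\}$; $a_i\in\mathbb{R}^n$ is the transpose of the $i$-th row of $A$; $b_i$ is the $i$-th entry of $b$; $A^\dagger$ is the Moore–Penrose pseudoinverse; $\|A\|_F$ is the Frobenius norm; $\sigma_{\min}(A)$ is the smallest nonzero singular value of $A$. A zeroth power equals $1$. The mGRK method with parameters $\alpha>0$, $\beta\ge 0$, $\theta\in[0,1]$: starting from $x^{(0)}=x^{(1)}$, for $k=1,2,3,\dots$: (1) set $\mathcal{N}_k=\{i\in[m]:|\langle a_i,x^{(k)}\rangle-b_i|\ne 0\}$ and $\Gamma_k=\sum_{i\in\mathcal{N}_k}\|a_i\|_2^2$; (2) set $$\mathcal{S}_k=\left\{i\in[m]:\frac{|\langle a_i,x^{(k)}\rangle-b_i|^2}{\|a_i\|_2^2}\ge\theta\max_{j\in[m]}\frac{|\langle a_j,x^{(k)}\rangle-b_j|^2}{\|a_j\|_2^2}+(1-\theta)\frac{\|Ax^{(k)}-b\|_2^2}{\Gamma_k}\right\};$$ (3) select $i_k\in\mathcal{S}_k$ according to an arbitrary probability distribution $(p^{(k)}_i)_{i\in[m]}$ with $p_i^{(k)}=0$ for $i\notin\mathcal{S}_k$, $p_i^{(k)}\ge 0$ for $i\in\mathcal{S}_k$ and $\sum_{i\in\mathcal{S}_k}p_i^{(k)}=1$; (4) set $x^{(k+1)}=x^{(k)}-\alpha\frac{\langle a_{i_k},x^{(k)}\rangle-b_{i_k}}{\|a_{i_k}\|_2^2}a_{i_k}+\beta(x^{(k)}-x^{(k-1)})$.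 Degenerate case: if $Ax^{(k)}=b$, so that $\Gamma_k=0$, the quotient $\|Ax^{(k)}-b\|_2^2/\Gamma_k=0/0$ is read as $0$. *)

theory Defs
  imports "HOL-Analysis.Analysis" "HOL-Probability.Probability_Mass_Function"
begin

text \<open>The Moore--Penrose pseudoinverse, as the unique matrix satisfying the four Penrose
  equations.\<close>

definition is_pseudoinverse :: "real ^ 'n ^ 'm \<Rightarrow> real ^ 'm ^ 'n \<Rightarrow> bool" where
  "is_pseudoinverse A X \<longleftrightarrow>
     A ** X ** A = A \<and>
     X ** A ** X = X \<and>
     transpose (A ** X) = A ** X \<and>
     transpose (X ** A) = X ** A"

definition pseudoinverse :: "real ^ 'n ^ 'm \<Rightarrow> real ^ 'm ^ 'n" where
  "pseudoinverse A = (THE X. is_pseudoinverse A X)"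

definition frobenius_norm :: "real ^ 'n ^ 'm \<Rightarrow> real" where
  "frobenius_norm A = sqrt (\<Sum>i\<in>UNIV. \<Sum>j\<in>UNIV. (A $ i $ j)\<^sup>2)"

text \<open>Singular values are the square roots of the eigenvalues of \<open>A\<^sup>T A\<close>.  For a wide matrix this
  set may contain an additional zero, which does not affect the nonzero singular values.\<close>

definition singular_values :: "real ^ 'n ^ 'm \<Rightarrow> real set" where
  "singular_values A =
     {s. s \<ge> 0 \<and> (\<exists>v. v \<noteq> 0 \<and> (transpose A ** A) *v v = s\<^sup>2 *\<^sub>R v)}"

text \<open>Meaningful for \<open>A \<noteq> 0\<close> only, since otherwise the set is empty.\<close>

definition sigma_min :: "real ^ 'n ^ 'm \<Rightarrow> real" where
  "sigma_min A = Min (singular_values A - {0})"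

definition residual :: "real ^ 'n ^ 'm \<Rightarrow> real ^ 'm \<Rightarrow> real ^ 'n \<Rightarrow> 'm \<Rightarrow> real" where
  "residual A b y i = row i A \<bullet> y - b $ i"

definition violated_rows :: "real ^ 'n ^ 'm \<Rightarrow> real ^ 'm \<Rightarrow> real ^ 'n \<Rightarrow> 'm set" where
  "violated_rows A b y = {i. \<bar>residual A b y i\<bar> \<noteq> 0}"

definition Gamma_violated :: "real ^ 'n ^ 'm \<Rightarrow> real ^ 'm \<Rightarrow> real ^ 'n \<Rightarrow> real" where
  "Gamma_violated A b y = (\<Sum>i\<in>violated_rows A b y. (norm (row i A))\<^sup>2)"

text \<open>If \<open>A *v y = b\<close>, the last quotient is \<open>0 / 0\<close>, which is \<open>0\<close> as required.\<close>

definition greedy_set ::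
    "real ^ 'n ^ 'm \<Rightarrow> real ^ 'm \<Rightarrow> real \<Rightarrow> real ^ 'n \<Rightarrow> 'm set" where
  "greedy_set A b \<theta> y =
     {i. \<bar>residual A b y i\<bar>\<^sup>2 / (norm (row i A))\<^sup>2
          \<ge> \<theta> * (MAX j. \<bar>residual A b y j\<bar>\<^sup>2 / (norm (row j A))\<^sup>2)
            + (1 - \<theta>) * ((norm (A *v y - b))\<^sup>2 / Gamma_violated A b y)}"

text \<open>\<open>x\<close> is the iteration sequence of one realization of the method: \<open>p k\<close> is the (arbitrary,
  possibly history-dependent) distribution used in step \<open>k\<close>, and \<open>ix k\<close> the index drawn from it.
  The values of \<open>p\<close> and \<open>ix\<close> at \<open>0\<close> are irrelevant.\<close>

definition mGRK_sequence ::
    "real ^ 'n ^ 'm \<Rightarrow> real ^ 'm \<Rightarrow> real \<Rightarrow> real \<Rightarrow> real \<Rightarrow>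
     (nat \<Rightarrow> 'm pmf) \<Rightarrow> (nat \<Rightarrow> 'm) \<Rightarrow> (nat \<Rightarrow> real ^ 'n) \<Rightarrow> bool" where
  "mGRK_sequence A b \<alpha> \<beta> \<theta> p ix x \<longleftrightarrow>
     x 0 = x 1 \<and>
     (\<forall>k\<ge>1. set_pmf (p k) \<subseteq> greedy_set A b \<theta> (x k) \<and>
            ix k \<in> set_pmf (p k) \<and>
            x (k + 1) = x k
              - (\<alpha> * (residual A b (x k) (ix k) / (norm (row (ix k) A))\<^sup>2)) *\<^sub>R row (ix k) A
              + \<beta> *\<^sub>R (x k - x (k - 1)))"

end

theory Submission
  imports Defs
begin

text \<open>Write \<open>e\<^sub>k = x\<^sub>k - x\<^sup>\<star>\<close> and let \<open>P\<close> be the projection onto the selected row.  Expanding the update,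
  the cross terms \<open>\<langle>P e\<^sub>k, P e\<^sub>k\<^sub>-\<^sub>1\<rangle>\<close> are absorbed by the slack \<open>\<parallel>e\<^sub>k + e\<^sub>k\<^sub>-\<^sub>1\<parallel>\<^sup>2\<close> lost in
  \<open>\<parallel>e\<^sub>k - e\<^sub>k\<^sub>-\<^sub>1\<parallel>\<^sup>2 \<le> 2\<parallel>e\<^sub>k\<parallel>\<^sup>2 + 2\<parallel>e\<^sub>k\<^sub>-\<^sub>1\<parallel>\<^sup>2\<close>, because \<open>\<alpha> \<le> 1 + \<beta>\<close> when \<open>\<beta> > 0\<close>.  The greedy rule makes
  \<open>\<parallel>P e\<^sub>k\<parallel>\<^sup>2\<close> at least \<open>\<parallel>A e\<^sub>k\<parallel>\<^sup>2 / \<parallel>A\<parallel>\<^sub>F\<^sup>2\<close>, and since all \<open>e\<^sub>k\<close> lie in the row space this is at least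
  \<open>\<sigma>\<^sub>m\<^sub>i\<^sub>n\<^sup>2 \<parallel>e\<^sub>k\<parallel>\<^sup>2 / \<parallel>A\<parallel>\<^sub>F\<^sup>2\<close>.  This gives \<open>\<parallel>e\<^sub>k\<^sub>+\<^sub>1\<parallel>\<^sup>2 \<le> \<gamma>\<^sub>1 \<parallel>e\<^sub>k\<parallel>\<^sup>2 + \<gamma>\<^sub>2 \<parallel>e\<^sub>k\<^sub>-\<^sub>1\<parallel>\<^sup>2\<close>, and \<open>q\<close> is the larger root of
  \<open>q\<^sup>2 = \<gamma>\<^sub>1 q + \<gamma>\<^sub>2\<close>.\<close>

section \<open>Row space and pseudoinverse\<close>

text \<open>By default \<open>transpose A *v y\<close> is rewritten to \<open>y v* A\<close>, where
  \<open>matrix_vector_mul_assoc\<close> no longer applies.\<close>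

declare transpose_matrix_vector [simp del]

lemma inner_matrix_vector_mult:
  fixes A :: "real ^ 'n ^ 'm"
  shows "y \<bullet> (A *v v) = (transpose A *v y) \<bullet> v"
  by (simp add: dot_lmul_matrix transpose_matrix_vector)

text \<open>Encoded as the range of \<open>transpose A\<close>, so that membership supplies a
  preimage that moves across inner products.\<close>

definition row_space :: "real ^ 'n ^ 'm \<Rightarrow> (real ^ 'n) set" where
  "row_space A = range (\<lambda>y. transpose A *v y)"

lemma subspace_row_space: "subspace (row_space A)"
  unfolding row_space_def by (intro linear_subspace_image) auto

lemma row_space_transpose_mult [simp]: "transpose A *v y \<in> row_space A"
  by (auto simp: row_space_def)

lemma row_in_row_space: "row i A \<in> row_space A"
proof -
  have "row i A = transpose A *v axis i 1"
    by (simp add: matrix_vector_mult_basis column_transpose)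
  then show ?thesis by simp
qed

text \<open>Row space and kernel are orthogonal: writing \<open>v\<close> as
  \<open>transpose A *v y\<close> gives \<open>v \<bullet> v = y \<bullet> (A *v v)\<close>.\<close>

lemma row_space_kernel_zero:
  assumes "v \<in> row_space A" "A *v v = 0"
  shows "v = 0"
proof -
  obtain y where y: "v = transpose A *v y" using assms(1) by (auto simp: row_space_def)
  have "v \<bullet> v = y \<bullet> (A *v v)" by (subst (1) y) (simp add: inner_matrix_vector_mult)
  then show ?thesis using assms(2) by simp
qed

text \<open>\<open>A *v (v - w)\<close> lies both in the range of \<open>A\<close> and in the kernel
  of \<open>transpose A\<close>, hence is orthogonal to itself.\<close>

lemma normal_equation_imp_eq:
  fixes A :: "real ^ 'n ^ 'm"
  assumes "transpose A *v (A *v v) = transpose A *v (A *v w)"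
  shows "A *v v = A *v w"
proof -
  have "transpose A *v (A *v (v - w)) = 0"
    using assms by (simp add: matrix_vector_mult_diff_distrib)
  then have "(A *v (v - w)) \<bullet> (A *v (v - w)) = 0"
    by (metis inner_matrix_vector_mult inner_zero_left)
  then show ?thesis by (simp add: matrix_vector_mult_diff_distrib)
qed

lemma normal_equation_unique:
  assumes "v \<in> row_space A" "w \<in> row_space A"
    and "transpose A *v (A *v v) = transpose A *v (A *v w)"
  shows "v = w"
proof -
  have "v - w \<in> row_space A" using assms subspace_row_space subspace_diff by blast
  moreover have "A *v (v - w) = 0"
    using normal_equation_imp_eq[OF assms(3)] by (simp add: matrix_vector_mult_diff_distrib)
  ultimately show ?thesis using row_space_kernel_zero[of "v - w" A] by simp
qed

text \<open>Two orthogonal splittings: \<open>y = c + r\<close> along the range of \<open>A\<close>,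
  where \<open>transpose A\<close> kills \<open>r\<close>; then a preimage \<open>u = v + n\<close>
  of \<open>c\<close> along the row space, where \<open>A\<close> kills \<open>n\<close>.\<close>

lemma normal_equation_solvable:
  fixes A :: "real ^ 'n ^ 'm"
  shows "\<exists>v\<in>row_space A. transpose A *v (A *v v) = transpose A *v y"
proof -
  have sub: "subspace (range ((*v) A))" by (intro linear_subspace_image) auto
  obtain c r where c: "c \<in> span (range ((*v) A))"
    and r: "\<And>w. w \<in> span (range ((*v) A)) \<Longrightarrow> orthogonal r w" and y: "y = c + r"
    using orthogonal_subspace_decomp_exists[of "range ((*v) A)" y] by blast
  obtain u where u: "c = A *v u" using c sub by (metis imageE span_eq_iff)
  have "(transpose A *v r) \<bullet> (transpose A *v r) = r \<bullet> (A *v (transpose A *v r))"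
    by (simp add: inner_matrix_vector_mult)
  also have "\<dots> = 0" using r span_base unfolding orthogonal_def by blast
  finally have Ar: "transpose A *v r = 0" by simp
  obtain v n where v: "v \<in> span (row_space A)"
    and n: "\<And>w. w \<in> span (row_space A) \<Longrightarrow> orthogonal n w" and u': "u = v + n"
    using orthogonal_subspace_decomp_exists[of "row_space A" u] by blast
  have "(A *v n) \<bullet> (A *v n) = (transpose A *v (A *v n)) \<bullet> n"
    by (simp add: inner_matrix_vector_mult)
  also have "\<dots> = 0"
    using n[OF span_base[OF row_space_transpose_mult]]
    unfolding orthogonal_def by (simp add: inner_commute)
  finally have An: "A *v n = 0" by simp
  have "transpose A *v (A *v v) = transpose A *v y"
    by (simp add: y u u' An Ar matrix_vector_right_distrib)
  moreover have "v \<in> row_space A" using v subspace_row_space by (metis span_eq_iff)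
  ultimately show ?thesis by blast
qed

lemma symmetric_matrixI:
  fixes B :: "real ^ 'n ^ 'n"
  assumes "\<And>y z. (B *v y) \<bullet> z = y \<bullet> (B *v z)"
  shows "transpose B = B"
proof -
  have "(transpose B *v y) = B *v y" for y
    by (rule vector_eq_rdot[THEN iffD1]) (metis assms inner_matrix_vector_mult)
  then show ?thesis by (simp add: matrix_eq)
qed

text \<open>The pseudoinverse maps \<open>y\<close> to the solution in the row space of the normal equation
  \<open>A\<^sup>T A v = A\<^sup>T y\<close>.\<close>

lemma is_pseudoinverse_exists:
  fixes A :: "real ^ 'n ^ 'm"
  shows "\<exists>X. is_pseudoinverse A X"
proof -
  define f where "f y = (SOME v. v \<in> row_space A \<and> transpose A *v (A *v v) = transpose A *v y)" for y
  have f: "f y \<in> row_space A \<and> transpose A *v (A *v f y) = transpose A *v y" for y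
    unfolding f_def by (rule someI_ex) (use normal_equation_solvable[of A y] in blast)
  have unique: "f y = v"
    if "v \<in> row_space A" "transpose A *v (A *v v) = transpose A *v y" for v y
    using normal_equation_unique[of "f y" A v] f[of y] that by simp
  have "linear f"
  proof (rule linearI)
    show "f (y + z) = f y + f z" for y z
      by (rule unique)
        (use f in \<open>auto simp: matrix_vector_right_distrib intro: subspace_add[OF subspace_row_space]\<close>)
    show "f (c *\<^sub>R y) = c *\<^sub>R f y" for c y
      by (rule unique)
        (use f in \<open>auto simp: matrix_vector_mult_scaleR intro: subspace_scale[OF subspace_row_space]\<close>)
  qed
  define X where "X = matrix f"
  have X: "X *v y = f y" for y using \<open>linear f\<close> by (simp add: X_def)
  have AfA: "A *v f (A *v w) = A *v w" for w
    using normal_equation_imp_eq f by blast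
  have fAf: "f (A *v f y) = f y" for y
    using unique f by blast
  \<comment> \<open>The right-hand side is symmetric in \<open>y\<close> and \<open>z\<close>, so
    \<open>A\<close> after \<open>f\<close> is self-adjoint; \<open>fA\<close> does the same for
    \<open>f\<close> after \<open>A\<close>.\<close>
  have Af: "(A *v f y) \<bullet> z = (A *v f y) \<bullet> (A *v f z)" for y z
  proof -
    have "z \<bullet> (A *v f y) = (transpose A *v (A *v f z)) \<bullet> f y"
      using f by (simp add: inner_matrix_vector_mult)
    also have "\<dots> = (A *v f z) \<bullet> (A *v f y)" by (simp only: inner_matrix_vector_mult)
    finally show ?thesis by (simp only: inner_commute)
  qed
  have fA: "f (A *v w) \<bullet> u = f (A *v w) \<bullet> f (A *v u)" for w u
  proof -
    obtain y where "f (A *v w) = transpose A *v y"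
      using f[of "A *v w"] by (auto simp: row_space_def)
    then show ?thesis
      by (simp add: inner_matrix_vector_mult[symmetric] AfA)
  qed
  have "is_pseudoinverse A X"
    unfolding is_pseudoinverse_def
  proof (intro conjI)
    show "A ** X ** A = A" "X ** A ** X = X"
      by (simp_all add: matrix_eq matrix_vector_mul_assoc[symmetric] X AfA fAf)
    show "transpose (A ** X) = A ** X"
    proof (rule symmetric_matrixI)
      show "((A ** X) *v y) \<bullet> z = y \<bullet> ((A ** X) *v z)" for y z
        using Af[of y z] Af[of z y] by (simp add: matrix_vector_mul_assoc[symmetric] X inner_commute)
    qed
    show "transpose (X ** A) = X ** A"
    proof (rule symmetric_matrixI)
      show "((X ** A) *v y) \<bullet> z = y \<bullet> ((X ** A) *v z)" for y z
        using fA[of y z] fA[of z y] by (simp add: matrix_vector_mul_assoc[symmetric] X inner_commute)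
    qed
  qed
  then show ?thesis ..
qed

text \<open>Penrose's argument: transposing a product of two symmetric projections swaps them, which
  forces \<open>A ** X = A ** Y\<close> and \<open>X ** A = Y ** A\<close>.\<close>

lemma is_pseudoinverse_unique:
  fixes A :: "real ^ 'n ^ 'm"
  assumes "is_pseudoinverse A X" "is_pseudoinverse A Y"
  shows "X = Y"
proof -
  note P = assms[unfolded is_pseudoinverse_def]
  have AX: "A ** X = A ** Y"
  proof -
    have "A ** X = transpose (A ** Y ** (A ** X))"
      using P by (simp add: matrix_mul_assoc)
    also have "\<dots> = A ** X ** (A ** Y)" using P by (simp add: matrix_transpose_mul)
    also have "\<dots> = A ** Y" using P by (simp add: matrix_mul_assoc)
    finally show ?thesis .
  qed
  have XA: "X ** A = Y ** A"
  proof -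
    have "X ** A = transpose (X ** A ** (Y ** A))"
      using P by (metis matrix_mul_assoc)
    also have "\<dots> = Y ** A ** (X ** A)" using P by (simp add: matrix_transpose_mul)
    also have "\<dots> = Y ** A" using P by (metis matrix_mul_assoc)
    finally show ?thesis .
  qed
  have "X = X ** A ** X" using P by simp
  also have "\<dots> = Y ** (A ** X)" by (simp add: XA matrix_mul_assoc)
  also have "\<dots> = Y ** A ** Y" by (simp add: AX matrix_mul_assoc)
  finally show ?thesis using P by simp
qed

lemma is_pseudoinverse_pseudoinverse: "is_pseudoinverse A (pseudoinverse A)"
proof -
  have "\<exists>!X. is_pseudoinverse A X"
    using is_pseudoinverse_exists is_pseudoinverse_unique by blast
  then show ?thesis unfolding pseudoinverse_def by (rule theI')
qed

text \<open>The only two facts about \<open>x_star\<close> that the convergence proof uses. The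
  second rests on the symmetry of \<open>?X ** A\<close>, which makes it factor through
  \<open>transpose A\<close>.\<close>

lemma pseudoinverse_projection:
  fixes A :: "real ^ 'n ^ 'm"
  assumes "A *v z = b"
    and "x_star = pseudoinverse A *v b + (mat 1 - pseudoinverse A ** A) *v y"
  shows "A *v x_star = b" "y - x_star \<in> row_space A"
proof -
  let ?X = "pseudoinverse A"
  have X: "A ** ?X ** A = A" "transpose (?X ** A) = ?X ** A"
    using is_pseudoinverse_pseudoinverse[of A] by (auto simp: is_pseudoinverse_def)
  have x: "x_star = y + (?X ** A) *v (z - y)"
    by (simp add: assms(2) assms(1)[symmetric] matrix_vector_mul_assoc
        matrix_vector_mult_diff_rdistrib matrix_vector_mult_diff_distrib)
  have "A *v x_star = A *v y + (A ** ?X ** A) *v (z - y)"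
    by (simp add: x matrix_vector_right_distrib matrix_vector_mul_assoc matrix_mul_assoc)
  then show "A *v x_star = b"
    using X assms by (simp add: matrix_vector_mult_diff_distrib)
  have "y - x_star = (transpose (?X ** A)) *v (y - z)"
    using X(2) by (simp add: x matrix_vector_mult_diff_distrib)
  also have "\<dots> = transpose A *v (transpose ?X *v (y - z))"
    by (simp add: matrix_transpose_mul matrix_vector_mul_assoc)
  finally show "y - x_star \<in> row_space A" by simp
qed

section \<open>The smallest nonzero singular value\<close>

text \<open>Makes the \<open>Min\<close> in \<open>sigma_min\<close> meaningful. Eigenvectors of the
  symmetric matrix \<open>transpose A ** A\<close> for distinct eigenvalues are orthogonal, hence
  independent.\<close>

lemma finite_singular_values:
  fixes A :: "real ^ 'n ^ 'm"
  shows "finite (singular_values A)"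
proof -
  let ?S = "singular_values A"
  have "\<forall>s\<in>?S. \<exists>v. v \<noteq> 0 \<and> (transpose A ** A) *v v = s\<^sup>2 *\<^sub>R v"
    by (simp add: singular_values_def)
  from bchoice[OF this] obtain v
    where v: "\<And>s. s \<in> ?S \<Longrightarrow> v s \<noteq> 0 \<and> (transpose A ** A) *v v s = s\<^sup>2 *\<^sub>R v s"
    by blast
  have orth: "v s \<bullet> v t = 0" if "s \<in> ?S" "t \<in> ?S" "s \<noteq> t" for s t
  proof -
    have "s\<^sup>2 * (v s \<bullet> v t) = ((transpose A ** A) *v v s) \<bullet> v t"
      using v that by simp
    also have "\<dots> = v s \<bullet> ((transpose A ** A) *v v t)"
      by (simp add: inner_matrix_vector_mult matrix_transpose_mul)
    also have "\<dots> = t\<^sup>2 * (v s \<bullet> v t)" using v that by simp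
    finally have "(s\<^sup>2 - t\<^sup>2) * (v s \<bullet> v t) = 0" by (simp add: algebra_simps)
    moreover have "s\<^sup>2 \<noteq> t\<^sup>2" using that by (auto simp: singular_values_def)
    ultimately show ?thesis by simp
  qed
  have "inj_on v ?S" using orth v by (metis inj_onI inner_eq_zero_iff)
  moreover have "independent (v ` ?S)"
    by (rule pairwise_orthogonal_independent)
      (use orth v in \<open>force simp: pairwise_def orthogonal_def\<close>)+
  ultimately show ?thesis
    using independent_imp_finite finite_imageD by blast
qed

text \<open>A minimiser of the Rayleigh quotient on the row space is an eigenvector of \<open>A\<^sup>T A\<close>.\<close>

lemma sigma_min_bound:
  fixes A :: "real ^ 'n ^ 'm"
  assumes "e \<in> row_space A"
  shows "(sigma_min A)\<^sup>2 * (norm e)\<^sup>2 \<le> (norm (A *v e))\<^sup>2"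
\<comment> \<open>If \<open>A = 0\<close>, \<open>sigma_min A\<close> is unspecified, but the row
  space is then trivial and only the case \<open>e = 0\<close> occurs.\<close>
proof (cases "e = 0")
  case False
  let ?V = "row_space A" and ?K = "sphere 0 1 \<inter> row_space A"
  have unit: "(1 / norm w) *\<^sub>R w \<in> ?K" if "w \<in> ?V" "w \<noteq> 0" for w
    using that subspace_scale[OF subspace_row_space] by simp
  have "compact ?K"
    by (intro compact_Int_closed compact_sphere closed_subspace subspace_row_space)
  moreover have "?K \<noteq> {}" using unit[OF assms False] by blast
  moreover have "continuous_on ?K (\<lambda>v. (norm (A *v v))\<^sup>2)"
    by (intro continuous_intros)
  ultimately obtain u where u: "u \<in> ?K"
    and min: "\<And>v. v \<in> ?K \<Longrightarrow> (norm (A *v u))\<^sup>2 \<le> (norm (A *v v))\<^sup>2"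
    using continuous_attains_inf by metis
  define \<mu> where "\<mu> = (norm (A *v u))\<^sup>2"
  have ray: "\<mu> * (norm w)\<^sup>2 \<le> (norm (A *v w))\<^sup>2" if "w \<in> ?V" for w
  proof (cases "w = 0")
    case False
    have "\<mu> \<le> (norm (A *v ((1 / norm w) *\<^sub>R w)))\<^sup>2"
      unfolding \<mu>_def by (rule min[OF unit[OF that False]])
    also have "\<dots> = (norm (A *v w))\<^sup>2 / (norm w)\<^sup>2"
      by (simp add: matrix_vector_mult_scaleR power_divide)
    finally show ?thesis using False by (simp add: field_simps)
  qed simp
  have nu: "u \<noteq> 0" "norm u = 1" "u \<in> ?V" using u by auto
  have \<mu>_pos: "\<mu> > 0"
    using row_space_kernel_zero[of u A] nu by (auto simp: \<mu>_def)
  \<comment> \<open>Half the gradient at \<open>u\<close> of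
    \<open>(norm (A *v w))\<^sup>2 - \<mu> * (norm w)\<^sup>2\<close>, which by \<open>ray\<close>
    is nonnegative on the row space and vanishes at \<open>u\<close>. Since \<open>g\<close> lies in
    the row space, moving along it is admissible.\<close>
  define g where "g = transpose A *v (A *v u) - \<mu> *\<^sub>R u"
  have gV: "g \<in> ?V"
    unfolding g_def using nu
    by (intro subspace_diff subspace_scale subspace_row_space row_space_transpose_mult)
  have "g \<bullet> g = 0"
  proof (rule ccontr)
    assume "g \<bullet> g \<noteq> 0"
    then have gg: "g \<bullet> g > 0" by simp
    define c where "c = (norm (A *v g))\<^sup>2 - \<mu> * (norm g)\<^sup>2"
    have quad: "0 \<le> 2 * t * (g \<bullet> g) + t\<^sup>2 * c" for t
    proof -
      have "u + t *\<^sub>R g \<in> ?V"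
        using nu gV by (intro subspace_add subspace_scale subspace_row_space)
      then have "\<mu> * (norm (u + t *\<^sub>R g))\<^sup>2 \<le> (norm (A *v u + t *\<^sub>R (A *v g)))\<^sup>2"
        using ray[of "u + t *\<^sub>R g"]
        by (simp add: matrix_vector_right_distrib matrix_vector_mult_scaleR)
      moreover have "(norm (u + t *\<^sub>R g))\<^sup>2 = 1 + 2 * t * (u \<bullet> g) + t\<^sup>2 * (norm g)\<^sup>2"
        using nu(2) unfolding norm_eq_1 power2_norm_eq_inner
        by (simp add: inner_add inner_commute power2_eq_square algebra_simps)
      moreover have "(norm (A *v u + t *\<^sub>R (A *v g)))\<^sup>2
          = \<mu> + 2 * t * ((A *v u) \<bullet> (A *v g)) + t\<^sup>2 * (norm (A *v g))\<^sup>2"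
        unfolding power2_norm_eq_inner \<mu>_def
        by (simp add: inner_add inner_commute power2_eq_square algebra_simps)
      moreover have "(A *v u) \<bullet> (A *v g) = g \<bullet> g + \<mu> * (u \<bullet> g)"
        unfolding inner_matrix_vector_mult g_def by (simp add: inner_diff inner_commute algebra_simps)
      ultimately show ?thesis unfolding c_def by (simp add: algebra_simps)
    qed
    \<comment> \<open>A negative step so short that \<open>t * c \<ge> - (g \<bullet> g)\<close>:
      the linear term wins and the quadratic turns negative.\<close>
    define t where "t = - (g \<bullet> g) / (\<bar>c\<bar> + 1)"
    have "t < 0" using gg by (simp add: t_def divide_neg_pos)
    have "t * (\<bar>c\<bar> + 1) = - (g \<bullet> g)" by (simp add: t_def)
    moreover have "t * (\<bar>c\<bar> + 1) \<le> t * c" using \<open>t < 0\<close> by (simp add: mult_le_cancel_left)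
    ultimately have "2 * (g \<bullet> g) + t * c > 0" using gg by linarith
    then have "t * (2 * (g \<bullet> g) + t * c) < 0" using \<open>t < 0\<close> by (simp add: mult_neg_pos)
    then show False using quad[of t] by (simp add: power2_eq_square algebra_simps)
  qed
  then have "(transpose A ** A) *v u = \<mu> *\<^sub>R u"
    by (simp add: g_def matrix_vector_mul_assoc)
  \<comment> \<open>Besides bounding the minimum, this witness shows that the set under
    \<open>Min\<close> is nonempty.\<close>
  then have "sqrt \<mu> \<in> singular_values A - {0}"
    using \<mu>_pos nu(1) by (auto simp: singular_values_def)
  moreover have fin: "finite (singular_values A - {0})" by (simp add: finite_singular_values)
  ultimately have "sigma_min A \<le> sqrt \<mu>" and "sigma_min A \<in> singular_values A - {0}"
    unfolding sigma_min_def using Min_le[OF fin] Min_in[OF fin] by blast+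
  then have "(sigma_min A)\<^sup>2 \<le> \<mu>"
    using \<mu>_pos power_mono[of "sigma_min A" "sqrt \<mu>" 2] by (auto simp: singular_values_def)
  then have "(sigma_min A)\<^sup>2 * (norm e)\<^sup>2 \<le> \<mu> * (norm e)\<^sup>2"
    by (intro mult_right_mono) auto
  then show ?thesis using ray[OF assms] by linarith
qed simp

section \<open>One step of the method\<close>

lemma frobenius_norm_rows:
  fixes A :: "real ^ 'n ^ 'm"
  shows "(frobenius_norm A)\<^sup>2 = (\<Sum>i\<in>UNIV. (norm (row i A))\<^sup>2)"
proof -
  have "(norm (row i A))\<^sup>2 = (\<Sum>j\<in>UNIV. (A $ i $ j)\<^sup>2)" for i
    unfolding power2_norm_eq_inner by (simp add: inner_vec_def row_def power2_eq_square)
  then show ?thesis by (simp add: frobenius_norm_def sum_nonneg)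
qed

lemma norm_residual:
  fixes A :: "real ^ 'n ^ 'm"
  shows "(norm (A *v y - b))\<^sup>2 = (\<Sum>i\<in>UNIV. (residual A b y i)\<^sup>2)"
  unfolding power2_norm_eq_inner
  by (simp add: inner_vec_def residual_def matrix_vector_mul_component row_def
      vec_lambda_eta power2_eq_square)

text \<open>The threshold is a convex combination of the largest ratio and the weighted mean over
  violated rows; both dominate the weighted mean over all rows.\<close>

lemma greedy_set_bound:
  fixes A :: "real ^ 'n ^ 'm"
  assumes rows: "\<And>i. row i A \<noteq> 0" and theta: "0 \<le> \<theta>" "\<theta> \<le> 1"
    and i: "i \<in> greedy_set A b \<theta> y"
  shows "(norm (A *v y - b))\<^sup>2 / (frobenius_norm A)\<^sup>2 \<le> (residual A b y i)\<^sup>2 / (norm (row i A))\<^sup>2"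
proof -
  let ?r = "residual A b y" and ?N = "(norm (A *v y - b))\<^sup>2" and ?F = "(frobenius_norm A)\<^sup>2"
  define M where "M = (MAX j. \<bar>?r j\<bar>\<^sup>2 / (norm (row j A))\<^sup>2)"
  have pos: "(norm (row j A))\<^sup>2 > 0" for j using rows by simp
  have Fpos: "?F > 0"
    unfolding frobenius_norm_rows using pos by (intro sum_pos) auto
  have "(?r j)\<^sup>2 / (norm (row j A))\<^sup>2 \<le> M" for j
    unfolding M_def by (rule Max_ge) auto
  then have "(?r j)\<^sup>2 \<le> M * (norm (row j A))\<^sup>2" for j
    using pos[of j] pos_divide_le_eq by blast
  then have "?N \<le> M * ?F"
    unfolding norm_residual frobenius_norm_rows sum_distrib_left by (intro sum_mono) auto
  then have 1: "?N / ?F \<le> M" using Fpos by (simp add: pos_divide_le_eq)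
  have 2: "?N / ?F \<le> ?N / Gamma_violated A b y"
  proof (cases "violated_rows A b y = {}")
    \<comment> \<open>Here \<open>y\<close> solves the system and both quotients are 0.\<close>
    case True
    then have "?r j = 0" for j by (auto simp: violated_rows_def)
    then show ?thesis by (simp add: norm_residual)
  next
    case False
    then have "Gamma_violated A b y > 0"
      unfolding Gamma_violated_def using pos by (intro sum_pos) auto
    moreover have "Gamma_violated A b y \<le> ?F"
      unfolding Gamma_violated_def frobenius_norm_rows by (intro sum_mono2) auto
    ultimately show ?thesis using Fpos by (intro divide_left_mono mult_pos_pos) auto
  qed
  have "?N / ?F = \<theta> * (?N / ?F) + (1 - \<theta>) * (?N / ?F)" by (simp only: distrib_right[symmetric]) simp
  also have "\<dots> \<le> \<theta> * M + (1 - \<theta>) * (?N / Gamma_violated A b y)"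
    using 1 2 theta by (intro add_mono mult_left_mono) auto
  also have "\<dots> \<le> (?r i)\<^sup>2 / (norm (row i A))\<^sup>2"
    using i by (simp add: greedy_set_def M_def)
  finally show ?thesis .
qed

lemma momentum_step_bound:
  fixes a d e :: "'a::real_inner" and \<alpha> \<beta> :: real
  assumes "a \<noteq> 0" and beta: "\<beta> \<ge> 0" and alpha: "0 < \<alpha>" "\<beta> > 0 \<Longrightarrow> \<alpha> \<le> 1 + \<beta>"
  shows "(norm (e - (\<alpha> * (a \<bullet> e / (norm a)\<^sup>2)) *\<^sub>R a + \<beta> *\<^sub>R (e - d)))\<^sup>2
    \<le> (2 * \<beta>\<^sup>2 + 3 * \<beta> + 1) * (norm e)\<^sup>2
      - (3 * \<alpha> * \<beta> + 2 * \<alpha> - \<alpha>\<^sup>2) * ((a \<bullet> e)\<^sup>2 / (norm a)\<^sup>2)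
      + (2 * \<beta>\<^sup>2 + \<beta>) * (norm d)\<^sup>2"
proof -
  define h where "h = a /\<^sub>R norm a"
  define s t where "s = h \<bullet> e" and "t = h \<bullet> d"
  have hh: "h \<bullet> h = 1"
    using \<open>a \<noteq> 0\<close> by (simp add: h_def power2_norm_eq_inner[symmetric] power2_eq_square field_simps)
  have proj: "(\<alpha> * (a \<bullet> e / (norm a)\<^sup>2)) *\<^sub>R a = (\<alpha> * s) *\<^sub>R h"
    using \<open>a \<noteq> 0\<close> by (simp add: h_def s_def power2_eq_square field_simps)
  have rho: "(a \<bullet> e)\<^sup>2 / (norm a)\<^sup>2 = s\<^sup>2"
    using \<open>a \<noteq> 0\<close> by (simp add: h_def s_def power2_eq_square field_simps)
  have hs: "h \<bullet> e = s" "e \<bullet> h = s" "h \<bullet> d = t" "d \<bullet> h = t" "d \<bullet> e = e \<bullet> d"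
    by (simp_all add: s_def t_def inner_commute)
  \<comment> \<open>An exact identity. The last bracket collects what the bound drops, with the
    cross terms in \<open>e \<bullet> d\<close> and \<open>s * t\<close> completed to squares; it
    remains to see that it is nonnegative.\<close>
  have expand: "(norm (e - (\<alpha> * s) *\<^sub>R h + \<beta> *\<^sub>R (e - d)))\<^sup>2
      = (2 * \<beta>\<^sup>2 + 3 * \<beta> + 1) * (norm e)\<^sup>2 - (3 * \<alpha> * \<beta> + 2 * \<alpha> - \<alpha>\<^sup>2) * s\<^sup>2
        + (2 * \<beta>\<^sup>2 + \<beta>) * (norm d)\<^sup>2
        - (\<beta> * (1 + \<beta>) * (norm (e + d))\<^sup>2 - \<alpha> * \<beta> * (s + t)\<^sup>2 + \<alpha> * \<beta> * t\<^sup>2)"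
    unfolding power2_norm_eq_inner
    by (simp add: inner_add inner_diff hs hh power2_eq_square algebra_simps)
  have "\<alpha> * \<beta> * (s + t)\<^sup>2 \<le> \<beta> * (1 + \<beta>) * (norm (e + d))\<^sup>2"
  \<comment> \<open>The bound on \<open>\<alpha>\<close> is available only for positive
    \<open>\<beta>\<close>; otherwise both sides vanish.\<close>
  proof (cases "\<beta> = 0")
    case False
    have "\<bar>s + t\<bar> \<le> norm (e + d)"
      using Cauchy_Schwarz_ineq2[of h "e + d"] hh by (simp add: hs inner_add norm_eq_sqrt_inner[of h])
    then have "(s + t)\<^sup>2 \<le> (norm (e + d))\<^sup>2" by (metis abs_ge_zero power2_abs power_mono)
    moreover have "\<alpha> * \<beta> \<le> \<beta> * (1 + \<beta>)" using alpha(2) beta False by (simp add: mult.commute)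
    ultimately show ?thesis using beta by (intro mult_mono[of "\<alpha> * \<beta>"]) auto
  qed simp
  moreover have "0 \<le> \<alpha> * \<beta> * t\<^sup>2" using alpha(1) beta by simp
  ultimately show ?thesis unfolding proj rho expand by linarith
qed

section \<open>The two-term recurrence\<close>

text \<open>With \<open>\<delta> = q - \<gamma>\<^sub>1\<close> the root equation reads
  \<open>\<gamma>\<^sub>2 = q * \<delta>\<close>, so \<open>F (k + 1) + \<delta> * F k\<close>
  shrinks by the factor \<open>q\<close> at each step.\<close>

lemma two_term_recurrence_bound:
  fixes F :: "nat \<Rightarrow> real"
  assumes nonneg: "\<And>k. 0 \<le> F k" and "F 1 = F 0"
    and rec: "\<And>k. F (k + 2) \<le> \<gamma>\<^sub>1 * F (k + 1) + \<gamma>\<^sub>2 * F k"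
    and root: "q\<^sup>2 = \<gamma>\<^sub>1 * q + \<gamma>\<^sub>2" and "0 \<le> q" "\<gamma>\<^sub>1 \<le> q"
  shows "F (k + 1) \<le> q ^ k * (1 + (q - \<gamma>\<^sub>1)) * F 0"
proof -
  define \<delta> where "\<delta> = q - \<gamma>\<^sub>1"
  have g2: "\<gamma>\<^sub>2 = q * \<delta>" using root by (simp add: \<delta>_def power2_eq_square algebra_simps)
  have "F (k + 1) + \<delta> * F k \<le> q ^ k * ((1 + \<delta>) * F 0)"
  proof (induction k)
    case 0
    then show ?case using \<open>F 1 = F 0\<close> by (simp add: algebra_simps)
  next
    case (Suc k)
    have "F (Suc k + 1) + \<delta> * F (Suc k) \<le> q * (F (k + 1) + \<delta> * F k)"
      using rec[of k] by (simp add: g2 \<delta>_def algebra_simps)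
    also have "\<dots> \<le> q * (q ^ k * ((1 + \<delta>) * F 0))"
      using Suc \<open>0 \<le> q\<close> by (rule mult_left_mono)
    finally show ?case by simp
  qed
  moreover have "0 \<le> \<delta> * F k" using \<open>\<gamma>\<^sub>1 \<le> q\<close> nonneg by (simp add: \<delta>_def)
  ultimately show ?thesis by (simp add: \<delta>_def mult.assoc)
qed

lemma larger_root_bounds:
  fixes \<gamma>\<^sub>1 \<gamma>\<^sub>2 q :: real
  assumes "\<gamma>\<^sub>1 + \<gamma>\<^sub>2 < 1" "0 \<le> \<gamma>\<^sub>2" and q: "q = (\<gamma>\<^sub>1 + sqrt (\<gamma>\<^sub>1\<^sup>2 + 4 * \<gamma>\<^sub>2)) / 2"
  shows "q\<^sup>2 = \<gamma>\<^sub>1 * q + \<gamma>\<^sub>2" "0 \<le> q" "\<gamma>\<^sub>1 \<le> q" "\<gamma>\<^sub>1 + \<gamma>\<^sub>2 \<le> q" "q < 1"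
proof -
  define R where "R = sqrt (\<gamma>\<^sub>1\<^sup>2 + 4 * \<gamma>\<^sub>2)"
  have R2: "R\<^sup>2 = \<gamma>\<^sub>1\<^sup>2 + 4 * \<gamma>\<^sub>2" using assms(2) by (simp add: R_def)
  have q': "q = (\<gamma>\<^sub>1 + R) / 2" by (simp add: q R_def)
  show root: "q\<^sup>2 = \<gamma>\<^sub>1 * q + \<gamma>\<^sub>2" using R2 by (simp add: q' power2_eq_square field_simps)
  have "\<bar>\<gamma>\<^sub>1\<bar> \<le> R"
    using assms(2) real_sqrt_le_mono[of "\<gamma>\<^sub>1\<^sup>2" "\<gamma>\<^sub>1\<^sup>2 + 4 * \<gamma>\<^sub>2"] by (simp add: R_def)
  then show "0 \<le> q" and "\<gamma>\<^sub>1 \<le> q" by (simp_all add: q')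
  \<comment> \<open>Squaring reduces this to
    \<open>\<gamma>\<^sub>1 + \<gamma>\<^sub>2 < 1\<close>.\<close>
  have "R < 2 - \<gamma>\<^sub>1"
    unfolding R_def using assms(1,2) by (intro real_less_lsqrt) (auto simp: power2_eq_square algebra_simps)
  then show "q < 1" by (simp add: q')
  have "\<gamma>\<^sub>2 = q * (q - \<gamma>\<^sub>1)" using root by (simp add: power2_eq_square algebra_simps)
  also have "\<dots> \<le> 1 * (q - \<gamma>\<^sub>1)"
    using \<open>q < 1\<close> \<open>\<gamma>\<^sub>1 \<le> q\<close> by (intro mult_right_mono) auto
  finally show "\<gamma>\<^sub>1 + \<gamma>\<^sub>2 \<le> q" by simp
qed

section \<open>Convergence of the errors\<close>

theorem theorem3p2:
  fixes A :: "real ^ 'n ^ 'm" and b :: "real ^ 'm"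
    and \<alpha> \<beta> \<theta> \<gamma>\<^sub>1 \<gamma>\<^sub>2 q \<delta> :: real
    and p :: "nat \<Rightarrow> 'm pmf" and ix :: "nat \<Rightarrow> 'm"
    and x :: "nat \<Rightarrow> real ^ 'n" and x_star :: "real ^ 'n"
  assumes rows_nonzero: "\<And>i. row i A \<noteq> 0"
    and consistent: "\<exists>z. A *v z = b"
    and theta: "0 \<le> \<theta>" "\<theta> \<le> 1"
    and x_star: "x_star = pseudoinverse A *v b + (mat 1 - pseudoinverse A ** A) *v x 0"
    and beta: "\<beta> \<ge> 0"
    and alpha_no_momentum: "\<beta> = 0 \<Longrightarrow> 0 < \<alpha> \<and> \<alpha> < 2"
    and alpha_momentum: "\<beta> > 0 \<Longrightarrow> 0 < \<alpha> \<and> \<alpha> < 1 + \<beta>"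
    and gamma1: "\<gamma>\<^sub>1 = 2 * \<beta>\<^sup>2 + 3 * \<beta> + 1
       - (3 * \<alpha> * \<beta> + 2 * \<alpha> - \<alpha>\<^sup>2) * ((sigma_min A)\<^sup>2 / (frobenius_norm A)\<^sup>2)"
    and gamma2: "\<gamma>\<^sub>2 = 2 * \<beta>\<^sup>2 + \<beta>"
    and gamma_sum: "\<gamma>\<^sub>1 + \<gamma>\<^sub>2 < 1"
    and mGRK: "mGRK_sequence A b \<alpha> \<beta> \<theta> p ix x"
    and q: "q = (\<gamma>\<^sub>1 + sqrt (\<gamma>\<^sub>1\<^sup>2 + 4 * \<gamma>\<^sub>2)) / 2"
    and delta: "\<delta> = q - \<gamma>\<^sub>1"
  shows "(\<forall>k. (norm (x (k + 1) - x_star))\<^sup>2 \<le> q ^ k * (1 + \<delta>) * (norm (x 0 - x_star))\<^sup>2)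
         \<and> \<gamma>\<^sub>1 + \<gamma>\<^sub>2 \<le> q \<and> q < 1"
proof -
  obtain z where z: "A *v z = b" using consistent by blast
  have Ax: "A *v x_star = b" and x0: "x 0 - x_star \<in> row_space A"
    using pseudoinverse_projection[OF z x_star] by auto
  define e where "e k = x k - x_star" for k
  have res: "residual A b (x k) i = row i A \<bullet> e k" for k i
  proof -
    have "b $ i = row i A \<bullet> x_star"
      by (simp add: Ax[symmetric] matrix_vector_mul_component row_def vec_lambda_eta)
    then show ?thesis by (simp add: residual_def e_def inner_diff_right)
  qed
  \<comment> \<open>The method starts at step 1, so indices are shifted to let the recurrence hold
    for every natural \<open>k\<close>.\<close>
  have start: "e 1 = e 0"
    and ix: "\<And>k. ix (k + 1) \<in> greedy_set A b \<theta> (x (k + 1))"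
    and step: "\<And>k. x (k + 1 + 1) = x (k + 1)
        - (\<alpha> * (residual A b (x (k + 1)) (ix (k + 1)) / (norm (row (ix (k + 1)) A))\<^sup>2))
          *\<^sub>R row (ix (k + 1)) A + \<beta> *\<^sub>R (x (k + 1) - x (k + 1 - 1))"
    using mGRK unfolding mGRK_sequence_def e_def
    by (simp, metis le_add2 subsetD, metis le_add2)
  have estep: "e (k + 2) = e (k + 1)
      - (\<alpha> * (row (ix (k + 1)) A \<bullet> e (k + 1) / (norm (row (ix (k + 1)) A))\<^sup>2)) *\<^sub>R row (ix (k + 1)) A
      + \<beta> *\<^sub>R (e (k + 1) - e k)" for k
    using step[of k] unfolding res by (simp add: e_def)
  have "e k \<in> row_space A \<and> e (k + 1) \<in> row_space A" for k
  proof (induction k)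
    case 0
    then show ?case using x0 start by (simp add: e_def)
  next
    case (Suc k)
    then have "e (k + 2) \<in> row_space A"
      unfolding estep
      by (intro subspace_add subspace_diff subspace_scale subspace_row_space row_in_row_space) auto
    then show ?case using Suc by simp
  qed
  then have eV: "e k \<in> row_space A" for k by blast
  \<comment> \<open>The bound \<open>\<alpha> < 2 + \<beta>\<close> covers both regimes and gives
    the sign of the coefficient that multiplies the lower bound on the projected error.\<close>
  have alpha: "0 < \<alpha>" "\<beta> > 0 \<Longrightarrow> \<alpha> \<le> 1 + \<beta>" "\<alpha> < 2 + \<beta>"
    using beta alpha_momentum alpha_no_momentum by (cases "\<beta> = 0", auto)+
  have coeff: "0 \<le> 3 * \<alpha> * \<beta> + 2 * \<alpha> - \<alpha>\<^sup>2"
  proof -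
    have "0 \<le> \<alpha> * (3 * \<beta> + 2 - \<alpha>)" using alpha beta by (intro mult_nonneg_nonneg) auto
    then show ?thesis by (simp add: power2_eq_square algebra_simps)
  qed
  have rec: "(norm (e (k + 2)))\<^sup>2 \<le> \<gamma>\<^sub>1 * (norm (e (k + 1)))\<^sup>2 + \<gamma>\<^sub>2 * (norm (e k))\<^sup>2" for k
  proof -
    let ?a = "row (ix (k + 1)) A" and ?e = "e (k + 1)" and ?F = "(frobenius_norm A)\<^sup>2"
    have "(sigma_min A)\<^sup>2 / ?F * (norm ?e)\<^sup>2 \<le> (norm (A *v ?e))\<^sup>2 / ?F"
      using divide_right_mono[OF sigma_min_bound[OF eV], of ?F "k + 1"] by simp
    also have "A *v ?e = A *v x (k + 1) - b"
      by (simp add: e_def matrix_vector_mult_diff_distrib Ax)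
    also have "(norm \<dots>)\<^sup>2 / ?F \<le> (?a \<bullet> ?e)\<^sup>2 / (norm ?a)\<^sup>2"
      using greedy_set_bound[OF rows_nonzero theta ix[of k]] by (simp add: res)
    finally have "(3 * \<alpha> * \<beta> + 2 * \<alpha> - \<alpha>\<^sup>2) * ((sigma_min A)\<^sup>2 / ?F * (norm ?e)\<^sup>2)
        \<le> (3 * \<alpha> * \<beta> + 2 * \<alpha> - \<alpha>\<^sup>2) * ((?a \<bullet> ?e)\<^sup>2 / (norm ?a)\<^sup>2)"
      using coeff by (rule mult_left_mono)
    moreover have "\<gamma>\<^sub>1 * (norm ?e)\<^sup>2 = (2 * \<beta>\<^sup>2 + 3 * \<beta> + 1) * (norm ?e)\<^sup>2
        - (3 * \<alpha> * \<beta> + 2 * \<alpha> - \<alpha>\<^sup>2) * ((sigma_min A)\<^sup>2 / ?F * (norm ?e)\<^sup>2)"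
      unfolding gamma1 by (simp only: left_diff_distrib mult.assoc)
    ultimately show ?thesis
      using momentum_step_bound[where a = ?a and e = ?e and d = "e k", OF rows_nonzero beta alpha(1,2)]
      unfolding estep gamma2 by linarith
  qed
  have "0 \<le> \<gamma>\<^sub>2" using beta by (simp add: gamma2)
  note root = larger_root_bounds[OF gamma_sum this q]
  have "(norm (e (k + 1)))\<^sup>2 \<le> q ^ k * (1 + (q - \<gamma>\<^sub>1)) * (norm (e 0))\<^sup>2" for k
    by (rule two_term_recurrence_bound[where F = "\<lambda>k. (norm (e k))\<^sup>2", OF _ _ rec root(1-3)])
      (simp_all add: start[unfolded One_nat_def])
  then show ?thesis using root(4,5) by (simp add: delta e_def)
qed

end
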